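(* Let $V$ be an optimal prefix-free machine. Suppose that $V^{-1}(s)$ is a finite set for all $s\in\{0,1\}^*$. Then the function $s\mapsto \#V^{-1}(s)$ on $\{0,1\}^*$ is not bounded above.
   Context: $\{0,1\}^*$ is the set of finite binary strings (including the empty string), and $|p|$ is the length of a string $p$. $\mathbb{N}=\{0,1,2,\dots\}$. $\#S$ is the cardinality of a set $S$, and $\operatorname{dom} f$ is the domain of definition of a (partial) function $f$. A subset of $\{0,1\}^*$ is prefix-free if no string in it is a prefix of another string in it. A prefix-free machine is a partial recursive function $C\colon\{0,1\}^*\to\{0,1\}^*$ such that $\operatorname{dom} C$ is a prefix-free set. For a prefix-free machine $C$ and $s\in\{0,1\}^*$, $C^{-1}(s)=\{\,p\in\operatorname{dom} C\mid C(p)=s\,\}$. A prefix-free machine $V$ is optimal if for each prefix-free machine $C$ there exists $d\in\mathbb{N}$ such that for every $p\in\operatorname{dom} C$ there is $q$ with $V(q)=C(p)$ and $|q|\le|p|+d$. *)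

theory Defs
  imports "HOL-Library.Sublist"
begin

section \<open>Partial recursive functions on the natural numbers\<close>

text \<open>
  A partial function of arity \<open>n\<close> is represented by a partial map on lists; only its values
  on lists of length \<open>n\<close> are meaningful, and the schemes below never look at other values.
\<close>

definition compose :: "(nat list \<rightharpoonup> nat) \<Rightarrow> (nat list \<rightharpoonup> nat) list \<Rightarrow> nat list \<rightharpoonup> nat" where
  "compose f gs xs = Option.bind (those (map (\<lambda>g. g xs) gs)) f"

primrec prim_rec :: "(nat list \<rightharpoonup> nat) \<Rightarrow> (nat list \<rightharpoonup> nat) \<Rightarrow> nat \<Rightarrow> nat list \<rightharpoonup> nat" where
  "prim_rec f g 0 ys = f ys"
| "prim_rec f g (Suc x) ys = Option.bind (prim_rec f g x ys) (\<lambda>r. g (x # r # ys))"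

text \<open>
  Unbounded search diverges if it meets an undefined value before the first zero.
\<close>

definition minimise :: "(nat list \<rightharpoonup> nat) \<Rightarrow> nat list \<rightharpoonup> nat" where
  "minimise f xs =
    (if \<exists>z. f (z # xs) = Some 0 \<and> (\<forall>y<z. f (y # xs) \<noteq> None)
     then Some (LEAST z. f (z # xs) = Some 0) else None)"

inductive partial_recursive :: "nat \<Rightarrow> (nat list \<rightharpoonup> nat) \<Rightarrow> bool" where
  zero: "partial_recursive n (\<lambda>xs. Some 0)"
| succ: "partial_recursive 1 (\<lambda>xs. Some (Suc (hd xs)))"
| proj: "i < n \<Longrightarrow> partial_recursive n (\<lambda>xs. Some (xs ! i))"
| comp: "partial_recursive (length gs) f \<Longrightarrow> (\<forall>g\<in>set gs. partial_recursive n g)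
    \<Longrightarrow> partial_recursive n (compose f gs)"
| prec: "partial_recursive n f \<Longrightarrow> partial_recursive (Suc (Suc n)) g
    \<Longrightarrow> partial_recursive (Suc n) (\<lambda>xs. prim_rec f g (hd xs) (tl xs))"
| mini: "partial_recursive (Suc n) f \<Longrightarrow> partial_recursive n (minimise f)"


section \<open>Partial recursive functions on binary strings\<close>

text \<open>
  Finite binary strings are identified with natural numbers by their position in the
  length-lexicographic order (empty string, 0, 1, 00, 01, 10, 11, 000, and so on);
  \<open>True\<close> is the digit 1.
\<close>

definition str_code :: "bool list \<Rightarrow> nat" where
  "str_code p = foldl (\<lambda>n b. 2 * n + (if b then 2 else 1)) 0 p"

lemma str_code_Nil [simp]: "str_code [] = 0"
  by (simp add: str_code_def)

lemma str_code_snoc [simp]: "str_code (p @ [b]) = 2 * str_code p + (if b then 2 else 1)"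
  by (simp add: str_code_def)

lemma bij_str_code: "bij str_code"
proof (rule bijI)
  have "str_code p = str_code q \<Longrightarrow> p = q" for p q
  proof (induction p arbitrary: q rule: rev_induct)
    case Nil
    then show ?case by (cases q rule: rev_cases) (auto split: if_splits)
  next
    case (snoc b p)
    then obtain c q' where q: "q = q' @ [c]"
      by (cases q rule: rev_cases) (auto split: if_splits)
    with snoc.prems have *: "2 * str_code p + (if b then 2 else 1)
        = 2 * str_code q' + (if c then 2 else 1)" by simp
    have "b = c" using * by (cases b; cases c; simp) presburger+
    with * q snoc.IH show ?case by auto
  qed
  then show "inj str_code" by (auto intro: injI)
  have "\<exists>p. str_code p = n" for n
  proof (induction n rule: less_induct)
    case (less n)
    show ?case
    proof (cases "n = 0")
      case True
      then show ?thesis by (intro exI[of _ "[]"]) simp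
    next
      case False
      then have "(n - 1) div 2 < n" by auto
      with less obtain p where p: "str_code p = (n - 1) div 2" by blast
      have "str_code (p @ [even n]) = n" using p False by auto
      then show ?thesis by blast
    qed
  qed
  then show "surj str_code" by (metis surjI)
qed

definition partial_recursive_str :: "(bool list \<rightharpoonup> bool list) \<Rightarrow> bool" where
  "partial_recursive_str C \<longleftrightarrow>
    (\<exists>f. partial_recursive 1 f \<and> (\<forall>p. f [str_code p] = map_option str_code (C p)))"


section \<open>Prefix-free machines\<close>

definition prefix_free :: "bool list set \<Rightarrow> bool" where
  "prefix_free S \<longleftrightarrow> (\<forall>p\<in>S. \<forall>q\<in>S. p \<noteq> q \<longrightarrow> \<not> prefix p q)"

definition prefix_free_machine :: "(bool list \<rightharpoonup> bool list) \<Rightarrow> bool" where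
  "prefix_free_machine C \<longleftrightarrow> partial_recursive_str C \<and> prefix_free (dom C)"

definition optimal :: "(bool list \<rightharpoonup> bool list) \<Rightarrow> bool" where
  "optimal V \<longleftrightarrow> prefix_free_machine V \<and>
    (\<forall>C. prefix_free_machine C \<longrightarrow>
      (\<exists>d::nat. \<forall>p\<in>dom C. \<exists>q\<in>dom V. V q = C p \<and> length q \<le> length p + d))"

definition programs :: "(bool list \<rightharpoonup> bool list) \<Rightarrow> bool list \<Rightarrow> bool list set" where
  "programs C s = {p \<in> dom C. C p = Some s}"

end

theory Submission
  imports Defs
begin

text \<open>
  Suppose the number of programs is bounded, and let \<open>k\<close> be the largest number such that
  infinitely many strings have at least \<open>k\<close> programs; all but finitely many strings then have at
  most \<open>k\<close>. A machine reading \<open>0\<^sup>n1\<close> can search for a string \<open>s\<close>, large enough not to be one of the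
  finitely many exceptions, with \<open>k\<close> programs of length at least about \<open>2n\<close>. These are all the
  programs of \<open>s\<close>, yet optimality yields one of length at most \<open>n + O(1)\<close>. The search needs a
  step-indexed evaluation of partial recursive functions, which is constructed by induction on
  their definition.
\<close>

section \<open>Total recursive functions\<close>

text \<open>
  Agreement is demanded on lists of length \<open>n\<close> only, since the values of a partial recursive
  function on other lists are junk.
\<close>

definition total_rec :: "nat \<Rightarrow> (nat list \<Rightarrow> nat) \<Rightarrow> bool" where
  "total_rec n g \<longleftrightarrow> (\<exists>f. partial_recursive n f \<and> (\<forall>xs. length xs = n \<longrightarrow> f xs = Some (g xs)))"

definition decidable :: "nat \<Rightarrow> (nat list \<Rightarrow> bool) \<Rightarrow> bool" where
  "decidable n P \<longleftrightarrow> total_rec n (\<lambda>xs. of_bool (P xs))"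

section \<open>Composition, projections and substitution of arguments\<close>

lemma total_rec_cong:
  assumes "total_rec n g" "\<And>xs. length xs = n \<Longrightarrow> h xs = g xs"
  shows "total_rec n h"
  using assms unfolding total_rec_def by auto

lemma those_map_Some: "(\<And>g. g \<in> set gs \<Longrightarrow> f g = Some (h g)) \<Longrightarrow> those (map f gs) = Some (map h gs)"
  by (induction gs) auto

lemma total_rec_comp:
  assumes "total_rec (length gs) f" "\<And>g. g \<in> set gs \<Longrightarrow> total_rec n g"
    and "\<And>xs. length xs = n \<Longrightarrow> h xs = f (map (\<lambda>g. g xs) gs)"
  shows "total_rec n h"
proof -
  obtain f' where f': "partial_recursive (length gs) f'"
    "\<And>xs. length xs = length gs \<Longrightarrow> f' xs = Some (f xs)"
    using assms(1) unfolding total_rec_def by blast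
  obtain \<phi> where \<phi>: "\<And>g. g \<in> set gs \<Longrightarrow> partial_recursive n (\<phi> g)"
    "\<And>g xs. g \<in> set gs \<Longrightarrow> length xs = n \<Longrightarrow> \<phi> g xs = Some (g xs)"
    using assms(2) unfolding total_rec_def by metis
  have "partial_recursive n (compose f' (map \<phi> gs))"
    using f'(1) \<phi>(1) by (intro partial_recursive.comp) auto
  moreover have "compose f' (map \<phi> gs) xs = Some (h xs)" if "length xs = n" for xs
  proof -
    have "those (map (\<lambda>g. g xs) (map \<phi> gs)) = Some (map (\<lambda>g. g xs) gs)"
      using \<phi>(2) that by (simp add: comp_def those_map_Some)
    then show ?thesis using f'(2) assms(3)[OF that] by (simp add: compose_def)
  qed
  ultimately show ?thesis unfolding total_rec_def by blast
qed

lemma total_rec_nth: "i < n \<Longrightarrow> total_rec n (\<lambda>xs. xs ! i)"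
  unfolding total_rec_def using partial_recursive.proj by blast

lemma total_rec_hd: "0 < n \<Longrightarrow> total_rec n hd"
  by (rule total_rec_cong[OF total_rec_nth[of 0]]) (auto simp: hd_conv_nth)

lemma total_rec_hd_drop: "i < n \<Longrightarrow> total_rec n (\<lambda>xs. hd (drop i xs))"
  by (rule total_rec_cong[OF total_rec_nth[of i]]) (auto simp: hd_drop_conv_nth)

lemma total_rec_hd_tl:
  "1 < n \<Longrightarrow> total_rec n (\<lambda>xs. hd (tl xs))"
  "2 < n \<Longrightarrow> total_rec n (\<lambda>xs. hd (tl (tl xs)))"
  "3 < n \<Longrightarrow> total_rec n (\<lambda>xs. hd (tl (tl (tl xs))))"
  using total_rec_hd_drop[of 1 n] total_rec_hd_drop[of 2 n] total_rec_hd_drop[of 3 n]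
  by (simp_all add: drop_Suc eval_nat_numeral)

text \<open>Recursions and searches put their bound variables in front of the parameters. This rule
  rearranges or discards such leading arguments; the parameters \<open>drop k xs\<close> are passed
  on as projections.\<close>

lemma total_rec_subst_drop:
  assumes "total_rec (length gs + n) f" "\<And>g. g \<in> set gs \<Longrightarrow> total_rec (k + n) g"
  shows "total_rec (k + n) (\<lambda>xs. f (map (\<lambda>g. g xs) gs @ drop k xs))"
proof (rule total_rec_comp[of "gs @ map (\<lambda>i xs. xs ! i) [k..<k + n]" f])
  show "total_rec (length (gs @ map (\<lambda>i xs. xs ! i) [k..<k + n])) f"
    using assms(1) by simp
  show "total_rec (k + n) g" if "g \<in> set (gs @ map (\<lambda>i xs. xs ! i) [k..<k + n])" for g
    using that assms(2) by (auto intro: total_rec_nth)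
  show "f (map (\<lambda>g. g xs) gs @ drop k xs) =
      f (map (\<lambda>g. g xs) (gs @ map (\<lambda>i xs. xs ! i) [k..<k + n]))" if "length xs = k + n" for xs
  proof -
    have "drop k xs = map ((!) xs) [k..<k + n]"
      by (rule nth_equalityI) (use that in auto)
    then show ?thesis by (simp add: comp_def)
  qed
qed

lemma total_rec_Suc: "total_rec n a \<Longrightarrow> total_rec n (\<lambda>xs. Suc (a xs))"
proof (rule total_rec_comp[of "[a]" "\<lambda>xs. Suc (hd xs)"])
  show "total_rec (length [a]) (\<lambda>xs. Suc (hd xs))"
    unfolding total_rec_def using partial_recursive.succ by force
qed auto

lemma total_rec_const: "total_rec n (\<lambda>xs. c)"
proof (induction c)
  case 0
  then show ?case unfolding total_rec_def using partial_recursive.zero by blast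
qed (rule total_rec_Suc)

section \<open>Primitive recursion and arithmetic\<close>

lemma total_rec_rec_nat:
  assumes a: "total_rec n a" and f: "total_rec n f"
    and g: "total_rec (Suc (Suc n)) (\<lambda>ys. g (hd ys) (hd (tl ys)) (tl (tl ys)))"
  shows "total_rec n (\<lambda>xs. rec_nat (f xs) (\<lambda>x r. g x r xs) (a xs))"
proof -
  obtain f' where f': "partial_recursive n f'"
    "\<And>xs. length xs = n \<Longrightarrow> f' xs = Some (f xs)"
    using f unfolding total_rec_def by blast
  obtain g' where g': "partial_recursive (Suc (Suc n)) g'"
    "\<And>xs. length xs = Suc (Suc n) \<Longrightarrow> g' xs = Some (g (hd xs) (hd (tl xs)) (tl (tl xs)))"
    using g unfolding total_rec_def by blast
  have "prim_rec f' g' x xs = Some (rec_nat (f xs) (\<lambda>x r. g x r xs) x)" if "length xs = n" for x xs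
    by (induction x) (use f'(2) g'(2) that in auto)
  then have "total_rec (Suc n) (\<lambda>ys. rec_nat (f (tl ys)) (\<lambda>x r. g x r (tl ys)) (hd ys))"
    unfolding total_rec_def using partial_recursive.prec[OF f'(1) g'(1)] by fastforce
  then have "total_rec (length [a] + n) (\<lambda>ys. rec_nat (f (tl ys)) (\<lambda>x r. g x r (tl ys)) (hd ys))"
    by simp
  \<comment> \<open>The scheme \<open>prec\<close> reads the recursion bound from the head of its
    list; substituting \<open>a\<close> there allows any recursive term as the bound.\<close>
  from total_rec_subst_drop[OF this, of 0] a show ?thesis by simp
qed

lemma total_rec_tl: "total_rec n f \<Longrightarrow> total_rec (Suc n) (\<lambda>xs. f (tl xs))"
  using total_rec_subst_drop[of "[]" n f 1] by (simp add: drop_Suc)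

lemma total_rec_add:
  assumes "total_rec n a" "total_rec n b"
  shows "total_rec n (\<lambda>xs. a xs + b xs)"
proof -
  have "total_rec n (\<lambda>xs. rec_nat (a xs) (\<lambda>x r. Suc r) (b xs))"
    by (intro total_rec_rec_nat total_rec_Suc total_rec_hd_tl assms) simp
  moreover have "rec_nat m (\<lambda>x r. Suc r) k = m + k" for m k by (induction k) auto
  ultimately show ?thesis by simp
qed

lemma total_rec_sum:
  assumes "total_rec n a" "total_rec (Suc n) (\<lambda>ys. g (hd ys) (tl ys))"
  shows "total_rec n (\<lambda>xs. \<Sum>j<a xs. g j xs)"
proof -
  \<comment> \<open>In a recursion step the list consists of the index, the accumulator and then
    \<open>xs\<close>; \<open>g\<close> has to skip the accumulator.\<close>
  have "total_rec (Suc (Suc n)) (\<lambda>ys. g (hd ys) (tl (tl ys)))"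
    using total_rec_subst_drop[of "[hd]" n "\<lambda>ys. g (hd ys) (tl ys)" 2] assms(2)
    by (simp add: total_rec_hd drop_Suc numeral_2_eq_2)
  then have "total_rec n (\<lambda>xs. rec_nat 0 (\<lambda>x r. r + g x xs) (a xs))"
    by (intro total_rec_rec_nat total_rec_add total_rec_hd_tl total_rec_const assms) simp_all
  moreover have "rec_nat 0 (\<lambda>x r. r + g x xs) k = (\<Sum>j<k. g j xs)" for k xs
    by (induction k) auto
  ultimately show ?thesis by simp
qed

lemma total_rec_mult:
  assumes "total_rec n a" "total_rec n b"
  shows "total_rec n (\<lambda>xs. a xs * b xs)"
  using total_rec_sum[OF assms(1), of "\<lambda>_. b"] total_rec_tl[OF assms(2)] by simp

lemma total_rec_pred:
  assumes "total_rec n a"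
  shows "total_rec n (\<lambda>xs. a xs - 1)"
proof -
  have "total_rec n (\<lambda>xs. rec_nat 0 (\<lambda>x r. x) (a xs))"
    by (intro total_rec_rec_nat total_rec_hd total_rec_const assms) simp
  moreover have "rec_nat 0 (\<lambda>x r. x) k = k - 1" for k by (cases k) auto
  ultimately show ?thesis by simp
qed

lemma total_rec_diff:
  assumes "total_rec n a" "total_rec n b"
  shows "total_rec n (\<lambda>xs. a xs - b xs)"
proof -
  have "total_rec n (\<lambda>xs. rec_nat (a xs) (\<lambda>x r. r - 1) (b xs))"
    by (intro total_rec_rec_nat total_rec_pred total_rec_hd_tl assms) simp
  moreover have "rec_nat m (\<lambda>x r. r - 1) k = m - k" for m k by (induction k) auto
  ultimately show ?thesis by simp
qed

lemma total_rec_power: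
  assumes "total_rec n a"
  shows "total_rec n (\<lambda>xs. c ^ a xs)"
proof -
  have "total_rec n (\<lambda>xs. rec_nat 1 (\<lambda>x r. c * r) (a xs))"
    by (intro total_rec_rec_nat total_rec_mult total_rec_hd_tl total_rec_const assms) simp
  moreover have "rec_nat 1 (\<lambda>x r. c * r) k = c ^ k" for k by (induction k) auto
  ultimately show ?thesis by simp
qed

section \<open>Decidable predicates, counting and bounded search\<close>

lemma decidable_not: "decidable n P \<Longrightarrow> decidable n (\<lambda>xs. \<not> P xs)"
  unfolding decidable_def
  by (rule total_rec_cong[OF total_rec_diff[OF total_rec_const[of n 1]]]) auto

lemma decidable_conj:
  "decidable n P \<Longrightarrow> decidable n Q \<Longrightarrow> decidable n (\<lambda>xs. P xs \<and> Q xs)"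
  unfolding decidable_def of_bool_conj by (rule total_rec_mult)

lemma decidable_le:
  assumes "total_rec n a" "total_rec n b"
  shows "decidable n (\<lambda>xs. a xs \<le> b xs)"
  \<comment> \<open>With truncated subtraction, \<open>1 - (a xs - b xs)\<close> is 1 if
    \<open>a xs \<le> b xs\<close> and 0 otherwise.\<close>
  unfolding decidable_def
  by (rule total_rec_cong[OF total_rec_diff[OF total_rec_const[of n 1] total_rec_diff[OF assms]]]) auto

lemma decidable_eq:
  assumes "total_rec n a" "total_rec n b"
  shows "decidable n (\<lambda>xs. a xs = b xs)"
  unfolding eq_iff by (intro decidable_conj decidable_le assms)

lemma total_rec_card:
  assumes "total_rec n a" "decidable (Suc n) (\<lambda>ys. P (hd ys) (tl ys))"
  shows "total_rec n (\<lambda>xs. card {j. j < a xs \<and> P j xs})"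
proof -
  have "(\<Sum>j<a xs. of_bool (P j xs)) = card {j. j < a xs \<and> P j xs}" for xs
    by (simp add: of_bool_def sum.If_cases Int_def)
  moreover have "total_rec n (\<lambda>xs. \<Sum>j<a xs. of_bool (P j xs))"
    using assms by (intro total_rec_sum) (auto simp: decidable_def)
  ultimately show ?thesis by simp
qed

text \<open>A witness exists iff the number of witnesses is nonzero, so this reduces to
  counting.\<close>

lemma decidable_ex:
  assumes "total_rec n a" "decidable (Suc n) (\<lambda>ys. P (hd ys) (tl ys))"
  shows "decidable n (\<lambda>xs. \<exists>j<a xs. P j xs)"
proof -
  have "decidable n (\<lambda>xs. \<not> card {j. j < a xs \<and> P j xs} \<le> 0)"
    by (intro decidable_not decidable_le total_rec_card total_rec_const assms)
  then show ?thesis by (simp add: card_eq_0_iff)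
qed

text \<open>The list is fixed, so this is a finite conjunction rather than a search up to a computed
  bound. It serves the composition scheme, where each inner function is tested.\<close>

lemma decidable_ball:
  "(\<And>a. a \<in> set as \<Longrightarrow> decidable n (P a)) \<Longrightarrow> decidable n (\<lambda>xs. \<forall>a\<in>set as. P a xs)"
proof (induction as)
  case Nil
  then show ?case by (simp add: decidable_def total_rec_const)
qed (simp add: decidable_conj)

lemma total_rec_if:
  assumes "decidable n P" "total_rec n a" "total_rec n b"
  shows "total_rec n (\<lambda>xs. if P xs then a xs else b xs)"
proof -
  have "total_rec n (\<lambda>xs. of_bool (P xs) * a xs + of_bool (\<not> P xs) * b xs)"
    using assms decidable_not[OF assms(1)] unfolding decidable_def
    by (intro total_rec_add total_rec_mult)
  then show ?thesis by (rule total_rec_cong) auto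
qed

text \<open>
  The result is shifted by one, \<open>0\<close> meaning that there is no \<open>j < m\<close> with \<open>P j\<close>.
\<close>

definition find_last :: "(nat \<Rightarrow> bool) \<Rightarrow> nat \<Rightarrow> nat" where
  "find_last P = rec_nat 0 (\<lambda>j r. if P j then Suc j else r)"

lemma find_last_SucD: "find_last P m = Suc j \<Longrightarrow> j < m \<and> P j"
  by (induction m) (auto simp: find_last_def less_Suc_eq split: if_splits)

lemma find_last_eq_0_iff: "find_last P m = 0 \<longleftrightarrow> (\<forall>j<m. \<not> P j)"
  by (induction m) (auto simp: find_last_def less_Suc_eq)

lemma total_rec_find_last:
  assumes "total_rec n a" "decidable (Suc n) (\<lambda>ys. P (hd ys) (tl ys))"
  shows "total_rec n (\<lambda>xs. find_last (\<lambda>j. P j xs) (a xs))"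
proof -
  have "decidable (Suc (Suc n)) (\<lambda>ys. P (hd ys) (tl (tl ys)))"
    using total_rec_subst_drop[of "[hd]" n "\<lambda>ys. of_bool (P (hd ys) (tl ys))" 2] assms(2)
    by (simp add: decidable_def total_rec_hd drop_Suc numeral_2_eq_2)
  then show ?thesis unfolding find_last_def
    by (intro total_rec_rec_nat total_rec_if total_rec_Suc total_rec_hd total_rec_hd_tl
        total_rec_const assms(1)) simp_all
qed

section \<open>Step-indexed evaluation\<close>

text \<open>
  \<open>F (t # xs)\<close> is the result of evaluating \<open>f xs\<close> for \<open>t\<close> steps: \<open>0\<close> if there is none yet, and
  \<open>Suc y\<close> for the result \<open>y\<close>.
\<close>

definition approximates :: "nat \<Rightarrow> (nat list \<Rightarrow> nat) \<Rightarrow> (nat list \<rightharpoonup> nat) \<Rightarrow> bool" where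
  "approximates n F f \<longleftrightarrow> (\<forall>xs. length xs = n \<longrightarrow>
     (\<forall>y. f xs = Some y \<longleftrightarrow> (\<exists>t. F (t # xs) = Suc y)) \<and>
     (\<forall>t t' y. F (t # xs) = Suc y \<longrightarrow> t \<le> t' \<longrightarrow> F (t' # xs) = Suc y))"

lemma approximatesI:
  assumes "\<And>xs y t. length xs = n \<Longrightarrow> F (t # xs) = Suc y \<Longrightarrow> f xs = Some y"
    and "\<And>xs y. length xs = n \<Longrightarrow> f xs = Some y \<Longrightarrow> \<exists>t. \<forall>t'\<ge>t. F (t' # xs) = Suc y"
    and "\<And>xs y t t'. length xs = n \<Longrightarrow> F (t # xs) = Suc y \<Longrightarrow> t \<le> t' \<Longrightarrow> F (t' # xs) = Suc y"
  shows "approximates n F f"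
  unfolding approximates_def using assms by blast

text \<open>Convergence is given as an eventually constant value, so that finitely many evaluations
  can be synchronised at the maximum of their step bounds.\<close>

lemma approximatesD:
  assumes "approximates n F f" "length xs = n"
  shows "F (t # xs) = Suc y \<Longrightarrow> f xs = Some y"
    and "f xs = Some y \<Longrightarrow> \<exists>t. \<forall>t'\<ge>t. F (t' # xs) = Suc y"
    and "F (t # xs) = Suc y \<Longrightarrow> t \<le> t' \<Longrightarrow> F (t' # xs) = Suc y"
  using assms unfolding approximates_def by blast+


section \<open>Approximations for composition, primitive recursion and minimisation\<close>

lemma approximates_comp:
  assumes f: "total_rec (Suc (length gs)) F" "approximates (length gs) F f"
    and g: "\<And>g. g \<in> set gs \<Longrightarrow> total_rec (Suc n) (G g) \<and> approximates n (G g) g"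
  shows "\<exists>H. total_rec (Suc n) H \<and> approximates n H (compose f gs)"
proof -
  \<comment> \<open>The outer and all inner evaluations share the step count \<open>hd ys\<close>.
    Subtracting 1 strips the \<open>Suc\<close> from finished inner results; a single unfinished one
    leaves the whole unfinished.\<close>
  define H where "H ys = (if \<forall>g\<in>set gs. \<not> G g ys \<le> 0
    then F (hd ys # map (\<lambda>g. G g ys - 1) gs) else 0)" for ys
  have "total_rec (Suc n) (\<lambda>ys. F (hd ys # map (\<lambda>g. G g ys - 1) gs))"
    by (rule total_rec_comp[of "hd # map (\<lambda>g ys. G g ys - 1) gs" F])
       (use f(1) g in \<open>auto simp: comp_def intro: total_rec_hd total_rec_pred[simplified]\<close>)
  then have "total_rec (Suc n) H"
    unfolding H_def using g
    by (intro total_rec_if decidable_ball decidable_not decidable_le total_rec_const) auto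
  moreover have "approximates n H (compose f gs)"
  proof (rule approximatesI)
    fix xs y t assume len: "length xs = n" and "H (t # xs) = Suc y"
    then have pos: "\<And>g. g \<in> set gs \<Longrightarrow> G g (t # xs) > 0"
      and F: "F (t # map (\<lambda>g. G g (t # xs) - 1) gs) = Suc y"
      by (auto simp: H_def split: if_splits)
    have "g xs = Some (G g (t # xs) - 1)" if "g \<in> set gs" for g
      using approximatesD(1)[of n "G g" g xs t "G g (t # xs) - 1"] g[OF that] pos[OF that] len
      by auto
    then have "those (map (\<lambda>g. g xs) gs) = Some (map (\<lambda>g. G g (t # xs) - 1) gs)"
      by (rule those_map_Some)
    then show "compose f gs xs = Some y"
      using approximatesD(1)[OF f(2) _ F] by (simp add: compose_def)
    fix t' assume "t \<le> t'"
    have "G g (t' # xs) = G g (t # xs)" if "g \<in> set gs" for g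
      using approximatesD(3)[of n "G g" g xs t "G g (t # xs) - 1" t'] g[OF that] pos[OF that] len
        \<open>t \<le> t'\<close> by auto
    moreover from this have "map (\<lambda>g. G g (t' # xs) - 1) gs = map (\<lambda>g. G g (t # xs) - 1) gs"
      by simp
    ultimately show "H (t' # xs) = Suc y"
      using approximatesD(3)[OF f(2) _ F \<open>t \<le> t'\<close>] pos by (simp add: H_def cong: map_cong)
  next
    fix xs y assume len: "length xs = n" and "compose f gs xs = Some y"
    then obtain zs where zs: "those (map (\<lambda>g. g xs) gs) = Some zs" and fz: "f zs = Some y"
      by (auto simp: compose_def bind_eq_Some_conv)
    have those_D: "those us = Some vs \<Longrightarrow> us = map Some vs" for us :: "nat option list" and vs
      by (induction us arbitrary: vs) (auto split: option.splits)
    from those_D[OF zs] have len_zs: "length zs = length gs"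
      by (metis length_map)
    have gz: "g xs = Some (the (g xs))" if "g \<in> set gs" for g
    proof -
      have "g xs \<in> set (map (\<lambda>g. g xs) gs)" using that by simp
      then show ?thesis using those_D[OF zs] by auto
    qed
    have zs_eq: "zs = map (\<lambda>g. the (g xs)) gs"
      using those_map_Some[of gs "\<lambda>g. g xs"] gz zs by auto
    have "\<forall>g\<in>set gs. \<exists>t. \<forall>t'\<ge>t. G g (t' # xs) = Suc (the (g xs))"
      using approximatesD(2)[OF _ len] g gz by blast
    then obtain T where T: "\<And>g t'. g \<in> set gs \<Longrightarrow> T g \<le> t' \<Longrightarrow> G g (t' # xs) = Suc (the (g xs))"
      by metis
    obtain t0 where t0: "\<And>t'. t0 \<le> t' \<Longrightarrow> F (t' # zs) = Suc y"
      using approximatesD(2)[OF f(2) len_zs fz] by blast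
    \<comment> \<open>Beyond the maximum of these finitely many step bounds, the inner results have
      settled to \<open>zs\<close> and the outer evaluation has finished.\<close>
    have "H (t' # xs) = Suc y" if t': "Max (insert t0 (T ` set gs)) \<le> t'" for t'
    proof -
      have "t0 \<le> t'" "\<And>g. g \<in> set gs \<Longrightarrow> T g \<le> t'" using t' by auto
      moreover from this have "map (\<lambda>g. G g (t' # xs) - 1) gs = zs"
        using T zs_eq by simp
      ultimately show ?thesis using t0 T by (simp add: H_def)
    qed
    then show "\<exists>t. \<forall>t'\<ge>t. H (t' # xs) = Suc y" by blast
  qed
  ultimately show ?thesis by blast
qed

lemma approximates_prim_rec:
  assumes f: "total_rec (Suc n) F" "approximates n F f"
    and g: "total_rec (Suc (Suc (Suc n))) G" "approximates (Suc (Suc n)) G g"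
  shows "\<exists>H. total_rec (Suc (Suc n)) H \<and>
    approximates (Suc n) H (\<lambda>xs. prim_rec f g (hd xs) (tl xs))"
proof -
  \<comment> \<open>One step count \<open>t\<close> serves all stages. An unfinished stage has value
    0, which every later stage inherits; otherwise \<open>r - 1\<close> is the actual intermediate
    result.\<close>
  define h where "h t xs = rec_nat (F (t # xs))
    (\<lambda>x r. if r \<le> 0 then 0 else G (t # x # (r - 1) # xs))" for t xs
  have "total_rec (2 + n) (\<lambda>ys. F (map (\<lambda>g. g ys) [hd] @ drop 2 ys))"
    using f(1) by (intro total_rec_subst_drop) (auto intro: total_rec_hd)
  \<comment> \<open>Inside the recursion the list consists of the index, the accumulator,
    \<open>t\<close>, the recursion bound and then \<open>xs\<close>, whereas \<open>G\<close>
    expects \<open>t\<close>, the index, the decoded accumulator and \<open>xs\<close>.\<close>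
  moreover have "total_rec (4 + n) (\<lambda>ys. G (map (\<lambda>g. g ys)
      [\<lambda>ys. hd (tl (tl ys)), hd, \<lambda>ys. hd (tl ys) - 1] @ drop 4 ys))"
  proof (rule total_rec_subst_drop)
    have "total_rec (4 + n) (\<lambda>ys. hd (tl ys) - 1)"
      by (intro total_rec_pred total_rec_hd_tl) simp
    then show "total_rec (4 + n) k"
      if "k \<in> set [\<lambda>ys. hd (tl (tl ys)), hd, \<lambda>ys. hd (tl ys) - 1]" for k
      using that by (auto intro: total_rec_hd total_rec_hd_tl)
  qed (use g(1) in \<open>simp add: eval_nat_numeral\<close>)
  ultimately have "total_rec (Suc (Suc n)) (\<lambda>ys. h (hd ys) (tl (tl ys)) (hd (tl ys)))"
    unfolding h_def
    by (intro total_rec_rec_nat total_rec_if decidable_le total_rec_const total_rec_hd_tl)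
       (simp_all add: eval_nat_numeral drop_Suc)
  moreover have "approximates (Suc n) (\<lambda>ys. h (hd ys) (tl (tl ys)) (hd (tl ys)))
      (\<lambda>xs. prim_rec f g (hd xs) (tl xs))"
  proof -
    have sound: "h t xs x = Suc y \<Longrightarrow> prim_rec f g x xs = Some y" if "length xs = n" for t x xs y
    proof (induction x arbitrary: y)
      case 0
      then show ?case using approximatesD(1)[OF f(2) that] by (simp add: h_def)
    next
      case (Suc x)
      then obtain r where r: "h t xs x = Suc r" "G (t # x # r # xs) = Suc y"
        by (cases "h t xs x") (auto simp: h_def)
      then show ?case using Suc.IH[OF r(1)] approximatesD(1)[OF g(2) _ r(2)] that by simp
    qed
    have complete: "prim_rec f g x xs = Some y \<Longrightarrow> \<exists>t. \<forall>t'\<ge>t. h t' xs x = Suc y"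
      if len: "length xs = n" for x xs y
    proof (induction x arbitrary: y)
      case 0
      then show ?case using approximatesD(2)[OF f(2) len] by (simp add: h_def)
    next
      case (Suc x)
      then obtain r where r: "prim_rec f g x xs = Some r" "g (x # r # xs) = Some y"
        by (auto simp: bind_eq_Some_conv)
      obtain t1 where t1: "\<And>t'. t1 \<le> t' \<Longrightarrow> h t' xs x = Suc r" using Suc.IH[OF r(1)] by blast
      obtain t2 where t2: "\<And>t'. t2 \<le> t' \<Longrightarrow> G (t' # x # r # xs) = Suc y"
        using approximatesD(2)[OF g(2) _ r(2)] len by auto
      have "h t' xs (Suc x) = Suc y" if "max t1 t2 \<le> t'" for t'
        using t1[of t'] t2[of t'] that by (simp add: h_def)
      then show ?case by blast
    qed
    have mono: "h t xs x = Suc y \<Longrightarrow> h t' xs x = Suc y" if "length xs = n" "t \<le> t'" for t t' x xs y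
    proof (induction x arbitrary: y)
      case 0
      then show ?case using approximatesD(3)[OF f(2) that(1) _ that(2)] by (simp add: h_def)
    next
      case (Suc x)
      then obtain r where r: "h t xs x = Suc r" "G (t # x # r # xs) = Suc y"
        by (cases "h t xs x") (auto simp: h_def)
      then show ?case using Suc.IH[OF r(1)] approximatesD(3)[OF g(2) _ r(2) that(2)] that
        by (simp add: h_def)
    qed
    show ?thesis
      by (rule approximatesI) (auto intro: sound complete mono)
  qed
  ultimately show ?thesis by blast
qed

text \<open>The least zero is at most the witness in the definition of \<open>minimise\<close>, so
  definedness below the witness passes to it, and minimality excludes earlier zeros.\<close>

lemma minimise_eq_Some_iff:
  "minimise f xs = Some z \<longleftrightarrow> f (z # xs) = Some 0 \<and> (\<forall>y<z. \<exists>v>0. f (y # xs) = Some v)"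
proof
  assume m: "minimise f xs = Some z"
  then have ex: "\<exists>z. f (z # xs) = Some 0 \<and> (\<forall>y<z. f (y # xs) \<noteq> None)"
    and z: "z = (LEAST z. f (z # xs) = Some 0)"
    by (auto simp: minimise_def split: if_splits)
  then obtain z' where z': "f (z' # xs) = Some 0" "\<forall>y<z'. f (y # xs) \<noteq> None" by blast
  have "f (z # xs) = Some 0" unfolding z by (rule LeastI[of "\<lambda>z. f (z # xs) = Some 0", OF z'(1)])
  moreover have "z \<le> z'" unfolding z by (rule Least_le[of "\<lambda>z. f (z # xs) = Some 0", OF z'(1)])
  moreover have "f (y # xs) \<noteq> Some 0" if "y < z" for y
    using not_less_Least that unfolding z by blast
  ultimately show "f (z # xs) = Some 0 \<and> (\<forall>y<z. \<exists>v>0. f (y # xs) = Some v)"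
    using z'(2) by (metis gr0I less_le_trans not_None_eq)
next
  assume z: "f (z # xs) = Some 0 \<and> (\<forall>y<z. \<exists>v>0. f (y # xs) = Some v)"
  then have "(LEAST z. f (z # xs) = Some 0) = z"
    by (intro Least_equality) (auto, metis leI less_irrefl option.inject)
  moreover have "\<exists>z. f (z # xs) = Some 0 \<and> (\<forall>y<z. f (y # xs) \<noteq> None)"
    using z by (intro exI[of _ z]) auto
  ultimately show "minimise f xs = Some z" by (simp add: minimise_def)
qed

lemma approximates_minimise:
  assumes f: "total_rec (Suc (Suc n)) F" "approximates (Suc n) F f"
  shows "\<exists>H. total_rec (Suc n) H \<and> approximates n H (minimise f)"
proof -
  \<comment> \<open>\<open>F\<close> equal to 1 encodes the value 0, and \<open>F\<close> at most 1
    means unfinished or value 0. So within \<open>t\<close> steps the zero at \<open>z\<close> is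
    confirmed and everything before it has a nonzero value.\<close>
  define P where "P z t xs \<longleftrightarrow> F (t # z # xs) = 1 \<and> \<not> (\<exists>y<z. F (t # y # xs) \<le> 1)" for z t xs
  have 1: "total_rec (2 + n) (\<lambda>ys. F (map (\<lambda>g. g ys) [\<lambda>ys. hd (tl ys), hd] @ drop 2 ys))"
    using f(1) by (intro total_rec_subst_drop) (auto intro: total_rec_hd total_rec_hd_tl)
  have 2: "total_rec (3 + n) (\<lambda>ys. F (map (\<lambda>g. g ys) [\<lambda>ys. hd (tl (tl ys)), hd] @ drop 3 ys))"
    using f(1) by (intro total_rec_subst_drop) (auto intro: total_rec_hd total_rec_hd_tl)
  \<comment> \<open>Here \<open>t\<close> limits both the steps of each evaluation and the
    candidates for \<open>z\<close>.\<close>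
  have "total_rec (Suc n) (\<lambda>ys. find_last (\<lambda>z. P z (hd ys) (tl ys)) (hd ys))"
    unfolding P_def using 1 2
    by (intro total_rec_find_last decidable_conj decidable_not decidable_ex decidable_eq
        decidable_le total_rec_const total_rec_hd)
       (simp_all add: eval_nat_numeral drop_Suc)
  moreover have "approximates n (\<lambda>ys. find_last (\<lambda>z. P z (hd ys) (tl ys)) (hd ys)) (minimise f)"
  proof -
    \<comment> \<open>For fixed \<open>t\<close> and \<open>xs\<close> at most one \<open>z\<close>
      satisfies \<open>P\<close>, so the last candidate found is the only one.\<close>
    have found: "find_last (\<lambda>z. P z t xs) t = Suc z \<longleftrightarrow> z < t \<and> P z t xs" for t xs z
    proof
      assume z: "z < t \<and> P z t xs"
      then obtain z' where z': "find_last (\<lambda>z. P z t xs) t = Suc z'"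
        using find_last_eq_0_iff[of "\<lambda>z. P z t xs" t] by (metis not0_implies_Suc)
      with find_last_SucD[OF z'] z show "find_last (\<lambda>z. P z t xs) t = Suc z"
        by (cases z z' rule: linorder_cases) (auto simp: P_def)
    qed (rule find_last_SucD)
    have pos: "\<exists>w>0. F (t # y # xs) = Suc w" if "P z t xs" "y < z" for y z t xs
      using that by (cases "F (t # y # xs)") (auto simp: P_def)
    show ?thesis
    proof (rule approximatesI; unfold list.sel found)
      fix xs z t assume len: "length xs = n" and z: "z < t \<and> P z t xs"
      show "minimise f xs = Some z"
        unfolding minimise_eq_Some_iff
      proof (intro conjI allI impI)
        show "f (z # xs) = Some 0"
          using approximatesD(1)[OF f(2), of "z # xs" t 0] len z by (simp add: P_def)
        fix y assume "y < z"
        then obtain w where "w > 0" "F (t # y # xs) = Suc w" using pos z by blast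
        then show "\<exists>v>0. f (y # xs) = Some v"
          using approximatesD(1)[OF f(2), of "y # xs" t w] len by auto
      qed
      fix t' assume "t \<le> t'"
      moreover have "F (t' # z # xs) = 1"
        using approximatesD(3)[OF f(2) _ _ \<open>t \<le> t'\<close>, of "z # xs"] len z by (simp add: P_def)
      moreover have "\<not> F (t' # y # xs) \<le> 1" if y: "y < z" for y
      proof -
        obtain w where "w > 0" "F (t # y # xs) = Suc w" using pos z y by blast
        then show ?thesis
          using approximatesD(3)[OF f(2) _ _ \<open>t \<le> t'\<close>, of "y # xs"] len by simp
      qed
      ultimately show "z < t' \<and> P z t' xs" using z by (auto simp: P_def)
    next
      fix xs z assume len: "length xs = n" and "minimise f xs = Some z"
      then have z: "f (z # xs) = Some 0" "\<And>y. y < z \<Longrightarrow> \<exists>v>0. f (y # xs) = Some v"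
        by (auto simp: minimise_eq_Some_iff)
      then have "\<forall>y\<le>z. \<exists>v. f (y # xs) = Some v" by (metis le_neq_implies_less)
      then have "\<exists>t. \<forall>t'\<ge>t. F (t' # y # xs) = Suc (the (f (y # xs)))" if "y \<le> z" for y
        using approximatesD(2)[OF f(2), of "y # xs"] len that by force
      then obtain T where
        T: "\<And>y t'. y \<le> z \<Longrightarrow> T y \<le> t' \<Longrightarrow> F (t' # y # xs) = Suc (the (f (y # xs)))"
        by metis
      have "z < t' \<and> P z t' xs" if t': "Max (insert (Suc z) (T ` {..z})) \<le> t'" for t'
      proof -
        have "z < t'" "\<And>y. y \<le> z \<Longrightarrow> T y \<le> t'" using t' by auto
        moreover have "F (t' # z # xs) = 1" using T[of z t'] calculation z(1) by simp
        moreover have "\<not> F (t' # y # xs) \<le> 1" if "y < z" for y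
          using T[of y t'] calculation z(2)[OF that] that by auto
        ultimately show ?thesis by (auto simp: P_def)
      qed
      then show "\<exists>t. \<forall>t'\<ge>t. z < t' \<and> P z t' xs" by blast
    qed
  qed
  ultimately show ?thesis by blast
qed

text \<open>Basic functions count as finished at every \<open>t\<close>, so \<open>Suc\<close> of
  their value works, with indices shifted past the step count. The other schemes are handled by the
  preceding lemmas.\<close>

lemma partial_recursive_approximates:
  "partial_recursive n f \<Longrightarrow> \<exists>F. total_rec (Suc n) F \<and> approximates n F f"
proof (induction rule: partial_recursive.induct)
  case (zero n)
  then show ?case
    by (intro exI[of _ "\<lambda>_. Suc 0"]) (auto simp: approximates_def total_rec_const)
next
  case succ
  show ?case
    by (intro exI[of _ "\<lambda>ys. Suc (Suc (hd (tl ys)))"])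
       (auto simp: approximates_def intro!: total_rec_Suc total_rec_hd_tl(1))
next
  case (proj i n)
  then show ?case
    by (intro exI[of _ "\<lambda>ys. Suc (ys ! Suc i)"])
       (auto simp: approximates_def intro: total_rec_Suc total_rec_nth)
next
  case (comp gs f n)
  then obtain F where "total_rec (Suc (length gs)) F" "approximates (length gs) F f" by blast
  moreover have "\<forall>g\<in>set gs. \<exists>F. total_rec (Suc n) F \<and> approximates n F g"
    using comp by blast
  then obtain G where
    "\<And>g. g \<in> set gs \<Longrightarrow> total_rec (Suc n) (G g) \<and> approximates n (G g) g"
    by metis
  ultimately show ?case by (rule approximates_comp)
next
  case (prec n f g)
  then show ?case using approximates_prim_rec by blast
next
  case (mini n f)
  then show ?case using approximates_minimise by blast
qed

section \<open>Searching for strings with many long programs\<close>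

text \<open>
  In the numbering of strings, \<open>0\<^sup>n1\<close> has the code \<open>x = 2^(n+1)\<close>, and the bound \<open>x * x\<close> on codes
  amounts to a lower bound of about \<open>2n\<close> on lengths.
\<close>

definition heavy :: "(nat list \<rightharpoonup> nat) \<Rightarrow> nat \<Rightarrow> nat \<Rightarrow> nat \<Rightarrow> bool" where
  "heavy f k x s \<longleftrightarrow> x \<le> s \<and>
    (\<exists>A. finite A \<and> card A = k \<and> A \<subseteq> {p. x * x \<le> p \<and> f [p] = Some s})"

text \<open>Having \<open>k\<close> long programs is confirmed by a finite computation, so one can
  search over a single bound \<open>t\<close> until a suitable string appears. Restricting
  \<open>g\<close> to inputs \<open>2 ^ Suc n\<close> makes the domain of the later machine
  prefix-free.\<close>

lemma search_heavy:
  assumes "partial_recursive 1 f"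
  obtains g where "partial_recursive 1 g"
    and "\<And>x s. g [x] = Some s \<Longrightarrow> (\<exists>n. x = 2 ^ Suc n) \<and> heavy f k x s"
    and "\<And>n s. heavy f k (2 ^ Suc n) s \<Longrightarrow> g [2 ^ Suc n] \<noteq> None"
proof -
  obtain F where F: "total_rec 2 F" "approximates 1 F f"
    using partial_recursive_approximates[OF assms] by (auto simp: numeral_2_eq_2)
  \<comment> \<open>\<open>t\<close> bounds the running time and the program codes, and in
    \<open>out\<close> also \<open>s\<close>. The bound \<open>n < x\<close> makes the test for
    powers decidable and loses nothing, since \<open>n < 2 ^ Suc n\<close>.\<close>
  define P where "P s t x \<longleftrightarrow> (x \<le> s \<and> k \<le> card {p. p < t \<and> F [t, p] = Suc s \<and> x * x \<le> p}) \<and>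
    (\<exists>n<x. x = 2 ^ Suc n)" for s t x
  define out where "out t x = find_last (\<lambda>s. P s t x) t" for t x
  have "total_rec 4 (\<lambda>ys. F [hd (tl (tl ys)), hd ys])"
    by (rule total_rec_comp[of "[\<lambda>ys. hd (tl (tl ys)), hd]" F])
       (use F(1) in \<open>auto simp: numeral_2_eq_2 intro: total_rec_hd total_rec_hd_tl\<close>)
  then have out: "total_rec 2 (\<lambda>ys. out (hd ys) (hd (tl ys)))"
    unfolding out_def P_def
    by (intro total_rec_find_last decidable_conj decidable_ex decidable_le decidable_eq
        total_rec_card total_rec_mult total_rec_power total_rec_Suc total_rec_hd total_rec_hd_tl
        total_rec_const) (simp_all add: eval_nat_numeral)
  \<comment> \<open>\<open>out\<close> is 0 while nothing has been found, so \<open>m\<close> has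
    value 1 until a success turns it into the zero that \<open>minimise\<close> looks for.\<close>
  have "decidable 2 (\<lambda>ys. out (hd ys) (hd (tl ys)) \<le> 0)"
    by (intro decidable_le out total_rec_const)
  then obtain m where m: "partial_recursive 2 m" "\<And>t x. m [t, x] = Some (of_bool (out t x \<le> 0))"
    unfolding decidable_def total_rec_def by fastforce
  obtain h where h: "partial_recursive 2 h" "\<And>t x. h [t, x] = Some (out t x - 1)"
    using total_rec_pred[OF out] unfolding total_rec_def by fastforce
  \<comment> \<open>At the first successful bound, \<open>h\<close> evaluates \<open>out\<close>
    again and removes its shift by one.\<close>
  define g where "g = compose h [minimise m, \<lambda>xs. Some (xs ! 0)]"
  have g_eq: "g [x] = map_option (\<lambda>t. out t x - 1) (minimise m [x])" for x
    by (cases "minimise m [x]") (simp_all add: g_def compose_def h(2))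
  show thesis
  proof (rule that[of g])
    have "partial_recursive 1 (minimise m)"
      using m(1) by (intro partial_recursive.mini) (simp add: numeral_2_eq_2)
    moreover have "partial_recursive 1 (\<lambda>xs. Some (xs ! 0))"
      by (rule partial_recursive.proj) simp
    ultimately show "partial_recursive 1 g"
      unfolding g_def using h(1)
      by (intro partial_recursive.comp) (auto simp: numeral_2_eq_2)
  next
    fix x s assume "g [x] = Some s"
    then obtain t where t: "minimise m [x] = Some t" and s: "s = out t x - 1"
      by (auto simp: g_eq)
    then have "out t x = Suc s" by (auto simp: minimise_eq_Some_iff m(2))
    then have P: "P s t x" using find_last_SucD[of "\<lambda>s. P s t x" t s] unfolding out_def by simp
    then have "k \<le> card {p. p < t \<and> F [t, p] = Suc s \<and> x * x \<le> p}" by (simp add: P_def)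
    from obtain_subset_with_card_n[OF this] obtain A where
      A: "A \<subseteq> {p. p < t \<and> F [t, p] = Suc s \<and> x * x \<le> p}" "card A = k" "finite A" .
    have "f [p] = Some s" if "F [t, p] = Suc s" for p
      using approximatesD(1)[OF F(2) _ that] by simp
    with A(1) have "A \<subseteq> {p. x * x \<le> p \<and> f [p] = Some s}" by blast
    moreover have "x \<le> s" "\<exists>n. x = 2 ^ Suc n" using P unfolding P_def by blast+
    ultimately show "(\<exists>n. x = 2 ^ Suc n) \<and> heavy f k x s"
      using A(2,3) unfolding heavy_def by blast
  next
    fix n s :: nat
    let ?x = "2 ^ Suc n :: nat"
    assume "heavy f k ?x s"
    then obtain A where A: "?x \<le> s" "finite A" "card A = k"
      "A \<subseteq> {p. ?x * ?x \<le> p \<and> f [p] = Some s}"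
      unfolding heavy_def by blast
    have "\<forall>p\<in>A. \<exists>t. \<forall>t'\<ge>t. F [t', p] = Suc s"
    proof
      fix p assume "p \<in> A"
      then show "\<exists>t. \<forall>t'\<ge>t. F [t', p] = Suc s"
        using approximatesD(2)[OF F(2), of "[p]" s] A(4) by auto
    qed
    then obtain T where T: "\<And>p t'. p \<in> A \<Longrightarrow> T p \<le> t' \<Longrightarrow> F [t', p] = Suc s" by metis
    \<comment> \<open>The successors give the strict bounds \<open>s < t\<close> and
      \<open>p < t\<close> that the search ranges demand.\<close>
    define t where "t = Max (insert (Suc s) (T ` A \<union> Suc ` A))"
    have "u \<le> t" if "u \<in> insert (Suc s) (T ` A \<union> Suc ` A)" for u
      unfolding t_def using that A(2) by (intro Max_ge) auto
    then have t: "s < t" "\<And>p. p \<in> A \<Longrightarrow> T p \<le> t" "\<And>p. p \<in> A \<Longrightarrow> p < t"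
      by (auto intro: Suc_le_lessD)
    have "A \<subseteq> {p. p < t \<and> F [t, p] = Suc s \<and> ?x * ?x \<le> p}"
      using A(4) T t by auto
    from card_mono[OF _ this] have "k \<le> card {p. p < t \<and> F [t, p] = Suc s \<and> ?x * ?x \<le> p}"
      using A(3) by simp
    moreover have "n < ?x" by (rule Suc_lessD[OF less_exp])
    ultimately have "P s t ?x" using A(1) unfolding P_def by blast
    then have "out t ?x \<noteq> 0" using t(1) unfolding out_def find_last_eq_0_iff by auto
    then have "m [t, ?x] = Some 0" by (simp add: m(2))
    then have "minimise m [?x] \<noteq> None"
      using m(2) unfolding minimise_def by auto
    then show "g [?x] \<noteq> None" by (simp add: g_eq)
  qed
qed

section \<open>Codes of strings and the prefix-free set of inputs\<close>

lemma str_code_less: "str_code p < 2 ^ Suc (length p)"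
proof -
  \<comment> \<open>The summand 2 makes the induction go through: a new digit turns a code
    \<open>c\<close> into at most \<open>2 * c + 2\<close>, so \<open>c + 2\<close> at most
    doubles.\<close>
  have "str_code p + 2 \<le> 2 ^ Suc (length p)"
    by (induction p rule: rev_induct) auto
  then show ?thesis by simp
qed

lemma str_code_replicate: "str_code (replicate n False @ [True]) = 2 ^ Suc n"
proof -
  have "Suc (str_code (replicate n False)) = 2 ^ n"
  proof (induction n)
    case (Suc n)
    have "replicate (Suc n) False = replicate n False @ [False]"
      by (simp add: replicate_append_same)
    then show ?case using Suc by simp
  qed simp
  then show ?thesis by simp
qed

text \<open>The position of the first \<open>True\<close> determines \<open>n\<close> and is the
  same in every extension.\<close>

lemma prefix_free_unary: "prefix_free (range (\<lambda>n. replicate n False @ [True]))"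
proof -
  have len: "length (takeWhile Not (replicate n False @ True # zs)) = n" for n zs
    by (induction n) simp_all
  have "m = n" if pre: "prefix (replicate m False @ [True]) (replicate n False @ [True])" for m n
  proof -
    obtain zs where "replicate n False @ [True] = replicate m False @ True # zs"
      using pre unfolding prefix_def by auto
    then show ?thesis using len[of n "[]"] len[of m zs] by simp
  qed
  then show ?thesis unfolding prefix_free_def by fast
qed

lemma finite_str_code_less: "finite {p. str_code p < b}"
  using finite_vimageI[of "{..<b}" str_code] bij_str_code by (simp add: vimage_def bij_def)

text \<open>Each \<open>n\<close> excludes only finitely many strings: those with a small code and
  those with a program of small code. Some string with at least \<open>k\<close> programs therefore
  remains, and the search halts on every input of the form \<open>0...01\<close>.\<close>

lemma exists_heavy_machine:
  assumes V: "partial_recursive_str V" and fin: "\<And>s. finite (programs V s)"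
    and inf: "infinite {s. k \<le> card (programs V s)}"
  obtains C where "prefix_free_machine C"
    and "\<And>n. \<exists>s A. C (replicate n False @ [True]) = Some s \<and> 2 ^ Suc n \<le> str_code s \<and>
      A \<subseteq> programs V s \<and> card A = k \<and> (\<forall>p\<in>A. 2 ^ Suc n * 2 ^ Suc n \<le> str_code p)"
proof -
  obtain f where f: "partial_recursive 1 f" "\<And>p. f [str_code p] = map_option str_code (V p)"
    using V unfolding partial_recursive_str_def by blast
  obtain g where g: "partial_recursive 1 g"
    "\<And>x s. g [x] = Some s \<Longrightarrow> (\<exists>n. x = 2 ^ Suc n) \<and> heavy f k x s"
    "\<And>n s. heavy f k (2 ^ Suc n) s \<Longrightarrow> g [2 ^ Suc n] \<noteq> None"
    using search_heavy[OF f(1)] by metis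
  define dec where "dec = inv str_code"
  have dec [simp]: "dec (str_code p) = p" "str_code (dec n) = n" for p n
    using bij_str_code by (simp_all add: dec_def bij_is_inj bij_is_surj surj_f_inv_f)
  have f_eq: "f [str_code p] = Some (str_code s) \<longleftrightarrow> p \<in> programs V s" for p s
    using bij_str_code by (auto simp: f(2) programs_def dom_def bij_def inj_eq)
  define C where "C p = map_option dec (g [str_code p])" for p
  show thesis
  proof (rule that[of C])
    have "partial_recursive_str C"
      unfolding partial_recursive_str_def
      by (intro exI[of _ g] conjI g(1)) (simp add: C_def option.map_comp comp_def option.map_ident)
    moreover have "prefix_free (dom C)"
    proof -
      have "p \<in> range (\<lambda>n. replicate n False @ [True])" if p: "p \<in> dom C" for p
      proof -
        obtain n where "str_code p = 2 ^ Suc n" using p g(2) by (cases "g [str_code p]") (auto simp: C_def)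
        then have "p = replicate n False @ [True]"
          using str_code_replicate[of n] dec(1)[of p] dec(1)[of "replicate n False @ [True]"] by simp
        then show ?thesis by blast
      qed
      then show ?thesis using prefix_free_unary unfolding prefix_free_def by meson
    qed
    ultimately show "prefix_free_machine C" by (simp add: prefix_free_machine_def)
  next
    fix n
    let ?x = "2 ^ Suc n :: nat"
    let ?small = "{p. str_code p < ?x * ?x}"
    \<comment> \<open>A program outputs only one string, so finitely many small programs affect
      finitely many strings.\<close>
    have "{s. programs V s \<inter> ?small \<noteq> {}} \<subseteq> (\<lambda>p. the (V p)) ` ?small"
    proof
      fix s assume "s \<in> {s. programs V s \<inter> ?small \<noteq> {}}"
      then obtain p where "V p = Some s" "p \<in> ?small" by (auto simp: programs_def)
      then show "s \<in> (\<lambda>p. the (V p)) ` ?small" by (intro image_eqI[of _ _ p]) simp_all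
    qed
    then have "finite {s. programs V s \<inter> ?small \<noteq> {}}"
      by (rule finite_subset) (rule finite_imageI[OF finite_str_code_less])
    then have "finite ({s. programs V s \<inter> ?small \<noteq> {}} \<union> {s. str_code s < ?x})"
      using finite_str_code_less by blast
    from infinite_imp_nonempty[OF Diff_infinite_finite[OF this inf]]
    obtain s where s: "k \<le> card (programs V s)" "programs V s \<inter> ?small = {}" "?x \<le> str_code s"
      by (auto simp del: power_Suc simp: not_less)
    obtain A where A: "A \<subseteq> programs V s" "card A = k" "finite A"
      using obtain_subset_with_card_n[OF s(1)] .
    have "heavy f k ?x (str_code s)"
      unfolding heavy_def
    proof (intro conjI exI[of _ "str_code ` A"])
      show "card (str_code ` A) = k"
        using card_image[OF inj_on_subset[OF bij_is_inj[OF bij_str_code] subset_UNIV]] A(2) by simp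
      show "str_code ` A \<subseteq> {p. ?x * ?x \<le> p \<and> f [p] = Some (str_code s)}"
      proof
        fix y assume "y \<in> str_code ` A"
        then obtain p where p: "y = str_code p" "p \<in> A" by blast
        then have "p \<in> programs V s" "p \<notin> ?small" using A(1) s(2) by blast+
        then show "y \<in> {p. ?x * ?x \<le> p \<and> f [p] = Some (str_code s)}"
          using p(1) f_eq by simp
      qed
    qed (use A(3) s(3) in auto)
    \<comment> \<open>The string \<open>s\<close> only guarantees that the search halts; the string
      it finds, with code \<open>y\<close>, may be another one.\<close>
    then obtain y where y: "g [?x] = Some y" using g(3) by blast
    then have "heavy f k ?x y" using g(2) by blast
    then obtain B where B: "?x \<le> y" "finite B" "card B = k"
      "B \<subseteq> {p. ?x * ?x \<le> p \<and> f [p] = Some y}"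
      unfolding heavy_def by blast
    have "C (replicate n False @ [True]) = Some (dec y)"
      unfolding C_def str_code_replicate y by simp
    moreover have "dec ` B \<subseteq> programs V (dec y)"
    proof
      fix p assume "p \<in> dec ` B"
      then have "f [str_code p] = Some y" using B(4) by auto
      then show "p \<in> programs V (dec y)" by (simp flip: f_eq)
    qed
    moreover have "card (dec ` B) = k"
      using B(3) by (metis card_image dec(2) inj_on_inverseI)
    moreover have "\<forall>p\<in>dec ` B. ?x * ?x \<le> str_code p" using B(4) by auto
    ultimately show "\<exists>s A. C (replicate n False @ [True]) = Some s \<and> ?x \<le> str_code s \<and>
      A \<subseteq> programs V s \<and> card A = k \<and> (\<forall>p\<in>A. ?x * ?x \<le> str_code p)"
      using B(1) by (intro exI[of _ "dec y"] exI[of _ "dec ` B"]) simp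
  qed
qed

section \<open>Contradiction with optimality\<close>

theorem corollary8:
  fixes V :: "bool list \<rightharpoonup> bool list"
  assumes "optimal V"
    and "\<And>s. finite (programs V s)"
  shows "\<not> bdd_above (range (\<lambda>s. card (programs V s)))"
proof
  assume "bdd_above (range (\<lambda>s. card (programs V s)))"
  then obtain b where b: "\<And>s. card (programs V s) \<le> b" by (auto simp: bdd_above_def)
  \<comment> \<open>\<open>K\<close> contains 0, as there are infinitely many strings, and is
    bounded by \<open>b\<close>, so it has a maximum.\<close>
  define K where "K = {k. infinite {s. k \<le> card (programs V s)}}"
  have "K \<subseteq> {..b}"
  proof
    fix k assume "k \<in> K"
    then have "infinite {s. k \<le> card (programs V s)}" by (simp add: K_def)
    from infinite_imp_nonempty[OF this] obtain s where "k \<le> card (programs V s)" by blast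
    then show "k \<in> {..b}" using b[of s] by simp
  qed
  then have "finite K" using finite_subset by blast
  moreover have "0 \<in> K" unfolding K_def using infinite_UNIV_listI by simp
  ultimately have "Max K \<in> K" by (intro Max_in) auto
  moreover have "Suc (Max K) \<notin> K"
    using Max_ge[OF \<open>finite K\<close>, of "Suc (Max K)"] by (meson Suc_n_not_le_n)
  moreover define k where "k = Max K"
  ultimately have inf: "infinite {s. k \<le> card (programs V s)}"
    and fin: "finite {s. Suc k \<le> card (programs V s)}" (is "finite ?E")
    by (auto simp: K_def)
  have "partial_recursive_str V"
    using assms(1) by (simp add: optimal_def prefix_free_machine_def)
  then obtain C where C: "prefix_free_machine C"
    and C_heavy: "\<And>n. \<exists>s A. C (replicate n False @ [True]) = Some s \<and> 2 ^ Suc n \<le> str_code s \<and>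
      A \<subseteq> programs V s \<and> card A = k \<and> (\<forall>p\<in>A. 2 ^ Suc n * 2 ^ Suc n \<le> str_code p)"
    using exists_heavy_machine[OF _ assms(2) inf] by metis
  obtain d where d: "\<forall>p\<in>dom C. \<exists>q\<in>dom V. V q = C p \<and> length q \<le> length p + d"
    using assms(1) C unfolding optimal_def by blast
  \<comment> \<open>\<open>n\<close> dominates the optimality constant, for the final length
    estimate, and the codes of all exceptional strings, so that
    \<open>2 ^ Suc n \<le> str_code s\<close> keeps \<open>s\<close> from being one.\<close>
  define n where "n = Max (insert d (str_code ` ?E))"
  have n: "d \<le> n" "\<And>s. s \<in> ?E \<Longrightarrow> str_code s \<le> n"
    unfolding n_def using fin by auto
  let ?p = "replicate n False @ [True]"
  obtain s A where s: "C ?p = Some s" "2 ^ Suc n \<le> str_code s"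
    and A: "A \<subseteq> programs V s" "card A = k" "\<forall>p\<in>A. 2 ^ Suc n * 2 ^ Suc n \<le> str_code p"
    using C_heavy by blast
  have "n < 2 ^ Suc n" by (rule Suc_lessD[OF less_exp])
  then have "s \<notin> ?E" using n(2) s(2) by fastforce
  \<comment> \<open>Not being exceptional, \<open>s\<close> has at most \<open>k\<close> programs,
    and \<open>A\<close> already supplies \<open>k\<close> of them.\<close>
  then have "A = programs V s"
    using A(1,2) by (intro card_seteq assms(2)) auto
  moreover obtain q where q: "q \<in> programs V s" "length q \<le> length ?p + d"
  proof -
    have "?p \<in> dom C" using s(1) by blast
    then obtain q where "q \<in> dom V" "V q = C ?p" "length q \<le> length ?p + d" using d by blast
    then show thesis using s(1) by (intro that[of q]) (simp_all add: programs_def)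
  qed
  ultimately have "2 ^ Suc n * 2 ^ Suc n \<le> str_code q" using A(3) by blast
  \<comment> \<open>The length of \<open>q\<close> is at most \<open>n + 1 + d\<close>, hence at
    most \<open>2 * n + 1\<close>, so its code is below \<open>2 ^ (2 * n + 2)\<close>, the very
    lower bound that holds for programs in \<open>A\<close>.\<close>
  also have "\<dots> < 2 ^ Suc (length q)" by (rule str_code_less)
  also have "\<dots> \<le> 2 ^ (Suc n + Suc n)" using q(2) n(1) by (intro power_increasing) auto
  finally show False by (simp add: power_add)
qed

end
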